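(* Let $p$ be a prime greater than $3$ and let $P$ be a finite $p$-group of coexponent $f(P) \geq 2$. Then the nilpotency class of $P$ satisfies $\mathrm{cl}(P) \leq 2 f(P) - 1$.
   Context: For a prime $p$ and a finite $p$-group $P$, the coexponent of $P$ is the least integer $f(P)$ such that $P$ possesses a cyclic subgroup of index $p^{f(P)}$. $\mathrm{cl}(P)$ denotes the nilpotency class of $P$. *)

theory Defs
  imports "HOL-Algebra.Elementary_Groups" "HOL-Computational_Algebra.Primes"
begin

definition finite_p_group :: "nat \<Rightarrow> ('a, 'b) monoid_scheme \<Rightarrow> bool" where
  "finite_p_group p G \<longleftrightarrow> group G \<and> finite (carrier G) \<and> (\<exists>n::nat. order G = p ^ n)"

(* For a finite p-group a suitable k always exists: the trivial subgroup has p-power index.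
   Otherwise LEAST may be unspecified. *)
definition coexponent :: "nat \<Rightarrow> ('a, 'b) monoid_scheme \<Rightarrow> nat" where
  "coexponent p G =
     (LEAST k. \<exists>H. subgroup H G \<and> cyclic_group (G\<lparr>carrier := H\<rparr>) \<and> card (rcosets\<^bsub>G\<^esub> H) = p ^ k)"

definition commutator_subgroup :: "('a, 'b) monoid_scheme \<Rightarrow> 'a set \<Rightarrow> 'a set \<Rightarrow> 'a set" where
  "commutator_subgroup G H K =
     generate G (\<Union>h\<in>H. \<Union>k\<in>K. {h \<otimes>\<^bsub>G\<^esub> k \<otimes>\<^bsub>G\<^esub> inv\<^bsub>G\<^esub> h \<otimes>\<^bsub>G\<^esub> inv\<^bsub>G\<^esub> k})"

(* Indexing starts at 0: lower_central G n is the term usually written gamma_(n+1)(G). *)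
primrec lower_central :: "('a, 'b) monoid_scheme \<Rightarrow> nat \<Rightarrow> 'a set" where
  "lower_central G 0 = carrier G"
| "lower_central G (Suc n) = commutator_subgroup G (lower_central G n) (carrier G)"

(* Meaningful only for nilpotent groups, in particular for finite p-groups with p prime;
   otherwise LEAST is unspecified. The trivial group has class 0. *)
definition nilpotency_class :: "('a, 'b) monoid_scheme \<Rightarrow> nat" where
  "nilpotency_class G = (LEAST c. lower_central G c = {\<one>\<^bsub>G\<^esub>})"

end

(* Let A = <x> be cyclic of index p^f in P. If p is odd and P is not cyclic, then P has a normal
   subgroup N of exponent p with [N, P] central which lies in no cyclic subgroup: take a maximal
   normal cyclic subgroup D and an element of P that has order p modulo D and is central modulo D,
   and correct it by an element of D so that its order becomes p. The image of A has index at most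
   p^(f-1) in P/N, and the class of P exceeds that of P/N by at most 2, so everything reduces to
   the class being at most 3 when f = 2. In that case P/N has class at most 2, so gamma_3(P) <= N.
   The subgroup A^p is normal of index at most p^3, so gamma_3(P) <= A^p. Hence gamma_3(P) lies in
   the normal subgroup of order at most p that N and A^p have in common, and this is central. *)
theory Submission
  imports Defs "HOL-Algebra.Multiplicative_Group" "HOL-Algebra.Group_Action" "HOL-Number_Theory.Residues"
begin

section \<open>An elementary congruence\<close>

text \<open>The induction has to start at f = 2, because 2f - 1 is false at f = 1: a nonabelian
  group of order p^3 with an element of order p^2 has class 2. Adding 2 per step from there would
  only give 2f; the separate argument at f = 2 gains the missing 1, and 3 + 2(f - 2) = 2f - 1. A
  step costs 2 because gamma_(c+1)(P) <= N puts the next term into [N, P], which is central and dies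
  one commutator later. The hypothesis carried along is \<open>order G \<le> p ^ f * ord x\<close>,
  an inequality about one element and not a statement on the coexponent, since the index of the
  image of A may drop by more than one factor p. Oddness of p enters through p dividing p(p - 1)/2.
  This gives the congruence below, which controls the automorphism that g induces on D, and it makes
  p-th powers multiplicative on pairs whose commutator is central and killed by p.\<close>

lemma prime_power_dvd_diff_one:
  fixes a p m :: nat
  assumes p: "Factorial_Ring.prime p" "odd p" and dvd: "int p ^ Suc m dvd int a ^ p - 1"
  shows "int p ^ m dvd int a - 1"
proof -
  define k where "k = int a"
  have dvd: "int p ^ Suc m dvd k ^ p - 1" using dvd by (simp add: k_def)
  have pi: "Factorial_Ring.prime (int p)" using p by simp
  have kp: "[k ^ p = 1] (mod int p)"
    using dvd by (metis cong_iff_dvd_diff dvd_mult_left power_Suc)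
  then have "\<not> int p dvd k"
    using p by (metis cong_dvd_iff dvd_power dvd_trans not_prime_unit pi prime_gt_0_nat dvd_power_same power_one_right dvd_refl)
  then have "\<not> p dvd a" by (simp add: k_def)
  then have "[a ^ (p - 1) = 1] (mod p)" using fermat_theorem p(1) by blast
  then have "[k ^ (p - 1) = 1] (mod int p)"
    unfolding k_def using cong_int_iff[of "a ^ (p - 1)" 1 p] by simp
  then have "[k * k ^ (p - 1) = k * 1] (mod int p)" by (rule cong_scalar_left)
  then have "[k ^ p = k] (mod int p)"
    using prime_gt_0_nat[OF p(1)] by (simp flip: power_eq_if add: power_eq_if[of k p])
  with kp have "[k = 1] (mod int p)" by (meson cong_sym cong_trans)
  then obtain t where t: "k = 1 + int p * t"
    by (metis cong_iff_dvd_diff dvdE diff_add_cancel add.commute)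
  \<comment> \<open>Since k^p - 1 = (k - 1) S, it suffices that p divides S exactly once. With k = 1
    + pt one has k^i = 1 + ipt modulo p^2, so S is p + pt p(p - 1)/2 there, and for odd p the second
    summand vanishes.\<close>
  define S where "S = (\<Sum>i<p. k ^ i)"
  have pow: "[k ^ i = 1 + int i * (int p * t)] (mod (int p)^2)" for i
  proof (induction i)
    case (Suc i)
    have "[k * k ^ i = k * (1 + int i * (int p * t))] (mod (int p)^2)"
      using Suc by (rule cong_scalar_left)
    moreover have "k * (1 + int i * (int p * t)) = 1 + int (Suc i) * (int p * t) + int p ^ 2 * (int i * t ^ 2)"
      by (simp add: t algebra_simps power2_eq_square)
    ultimately show ?case by (simp add: cong_def)
  qed simp
  have "[S = (\<Sum>i<p. 1 + int i * (int p * t))] (mod (int p)^2)"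
    unfolding S_def by (rule cong_sum) (rule pow)
  moreover have "(\<Sum>i<p. 1 + int i * (int p * t)) = int p + (\<Sum>i<p. int i) * (int p * t)"
    by (simp add: sum.distrib sum_distrib_right)
  moreover obtain q where q: "p = Suc (2 * q)" using p(2) oddE by fastforce
  have "(\<Sum>i<p. int i) = int p * int q"
  proof -
    have "2 * (\<Sum>i<n. int i) = int n * (int n - 1)" for n
      by (induction n) (auto simp: algebra_simps)
    from this[of p] show ?thesis using q by simp
  qed
  ultimately have "[S = int p + int p ^ 2 * (int q * t)] (mod (int p)^2)"
    by (simp add: power2_eq_square algebra_simps)
  then have "[S = int p] (mod (int p)^2)" by (simp add: cong_def)
  then obtain r where "S - int p = int p ^ 2 * r"
    unfolding cong_iff_dvd_diff by (elim dvdE)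
  then have S: "S = int p * (1 + int p * r)" by (simp add: power2_eq_square algebra_simps)
  have "k ^ p - 1 = (k - 1) * S" unfolding S_def by (rule power_diff_1_eq)
  then have "int p * int p ^ m dvd int p * ((k - 1) * (1 + int p * r))"
    using dvd S by (simp add: mult.left_commute)
  then have *: "int p ^ m dvd (k - 1) * (1 + int p * r)"
    using pi by (auto simp: mult_dvd_mono)
  have "coprime (int p) (1 + int p * r)"
    by (metis coprime_1_right coprime_iff_gcd_eq_1 gcd_add_mult mult.commute add.commute)
  then have "coprime (int p ^ m) (1 + int p * r)" by simp
  with * show ?thesis unfolding k_def using coprime_dvd_mult_left_iff by blast
qed

section \<open>Centre, commutators and the lower central series\<close>

definition centre :: "('a, 'b) monoid_scheme \<Rightarrow> 'a set" where
  "centre G = {z \<in> carrier G. \<forall>g\<in>carrier G. z \<otimes>\<^bsub>G\<^esub> g = g \<otimes>\<^bsub>G\<^esub> z}"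

context group
begin

definition commutator :: "'a \<Rightarrow> 'a \<Rightarrow> 'a" where
  "commutator x y = x \<otimes> y \<otimes> inv x \<otimes> inv y"

lemma commutator_closed [simp, intro]:
  "x \<in> carrier G \<Longrightarrow> y \<in> carrier G \<Longrightarrow> commutator x y \<in> carrier G"
  by (simp add: commutator_def)

lemma commutator_swap:
  "x \<in> carrier G \<Longrightarrow> y \<in> carrier G \<Longrightarrow> x \<otimes> y = commutator x y \<otimes> (y \<otimes> x)"
  by (simp add: commutator_def m_assoc) (simp flip: m_assoc)

lemma commutator_eqI:
  assumes "x \<in> carrier G" "y \<in> carrier G" "c \<in> carrier G" "x \<otimes> y = c \<otimes> (y \<otimes> x)"
  shows "commutator x y = c"
  using assms commutator_swap[OF assms(1,2)] by (metis commutator_closed m_closed right_cancel)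

lemma conj_eq_commutator_mult:
  "x \<in> carrier G \<Longrightarrow> y \<in> carrier G \<Longrightarrow> x \<otimes> y \<otimes> inv x = commutator x y \<otimes> y"
  by (simp add: commutator_def m_assoc)

lemma centreD: "z \<in> centre G \<Longrightarrow> g \<in> carrier G \<Longrightarrow> z \<otimes> g = g \<otimes> z"
  by (simp add: centre_def)

lemma centre_carrier [simp]: "z \<in> centre G \<Longrightarrow> z \<in> carrier G"
  by (simp add: centre_def)

lemma subgroup_centralizer:
  assumes x: "x \<in> carrier G"
  shows "subgroup {y \<in> carrier G. y \<otimes> x = x \<otimes> y} G"
proof (rule subgroupI)
  fix a assume "a \<in> {y \<in> carrier G. y \<otimes> x = x \<otimes> y}"
  then have a: "a \<in> carrier G" "a \<otimes> x = x \<otimes> a" by auto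
  have "inv a \<otimes> x = inv a \<otimes> (x \<otimes> a) \<otimes> inv a" using a(1) x by (simp add: m_assoc)
  also have "\<dots> = inv a \<otimes> (a \<otimes> x) \<otimes> inv a" by (simp only: a(2))
  also have "\<dots> = x \<otimes> inv a" using a(1) x by (simp flip: m_assoc)
  finally show "inv a \<in> {y \<in> carrier G. y \<otimes> x = x \<otimes> y}" using a by simp
next
  fix a b assume "a \<in> {y \<in> carrier G. y \<otimes> x = x \<otimes> y}" "b \<in> {y \<in> carrier G. y \<otimes> x = x \<otimes> y}"
  then have "a \<in> carrier G" "a \<otimes> x = x \<otimes> a" "b \<in> carrier G" "b \<otimes> x = x \<otimes> b" by auto
  with x have "a \<otimes> b \<otimes> x = x \<otimes> (a \<otimes> b)" by (metis m_assoc)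
  then show "a \<otimes> b \<in> {y \<in> carrier G. y \<otimes> x = x \<otimes> y}"
    using \<open>a \<in> carrier G\<close> \<open>b \<in> carrier G\<close> by simp
qed (use x in auto)

lemma subgroup_centre: "subgroup (centre G) G"
proof -
  have "centre G = \<Inter> ((\<lambda>x. {y \<in> carrier G. y \<otimes> x = x \<otimes> y}) ` carrier G)"
    using one_closed unfolding centre_def by blast
  moreover have "subgroup \<dots> G"
  proof (rule subgroups_Inter)
    fix H assume "H \<in> (\<lambda>x. {y \<in> carrier G. y \<otimes> x = x \<otimes> y}) ` carrier G"
    then show "subgroup H G" by (elim imageE) (simp only: subgroup_centralizer)
  qed (use one_closed in blast)
  ultimately show ?thesis by (simp only:)
qed

lemma centre_normal: "centre G \<lhd> G"
proof (rule normal_invI[OF subgroup_centre])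
  fix x h assume "x \<in> carrier G" "h \<in> centre G"
  then show "x \<otimes> h \<otimes> inv x \<in> centre G"
    by (metis centreD centre_carrier inv_closed m_assoc r_inv r_one)
qed

lemma commutator_eq_one: 
  assumes "x \<in> carrier G" "y \<in> carrier G"
  shows "commutator x y = \<one> \<longleftrightarrow> x \<otimes> y = y \<otimes> x"
  using assms by (metis commutator_eqI commutator_swap l_one m_closed one_closed)

lemma commutator_subgroup_subset:
  assumes "subgroup N G" "\<And>h k. h \<in> H \<Longrightarrow> k \<in> K \<Longrightarrow> commutator h k \<in> N"
  shows "commutator_subgroup G H K \<subseteq> N"
  unfolding commutator_subgroup_def
  by (rule generate_subgroup_incl[OF _ assms(1)]) (use assms(2) in \<open>auto simp: commutator_def\<close>)

lemma lower_central_carrier: "lower_central G n \<subseteq> carrier G"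
proof (induction n)
  case (Suc n)
  then show ?case unfolding lower_central.simps
    by (intro commutator_subgroup_subset subgroup_self) auto
qed simp

lemma one_in_lower_central: "\<one> \<in> lower_central G n"
  by (cases n) (auto simp: commutator_subgroup_def intro: generate.one)

lemma lower_central_trivial_mono:
  assumes "m \<le> n" "lower_central G m \<subseteq> {\<one>}"
  shows "lower_central G n = {\<one>}"
  using assms(1)
proof (induction n rule: dec_induct)
  case base
  then show ?case using assms(2) one_in_lower_central by auto
next
  case (step n)
  have "commutator_subgroup G {\<one>} (carrier G) \<subseteq> {\<one>}"
    by (rule commutator_subgroup_subset[OF triv_subgroup]) (auto simp: commutator_def)
  then show ?case using step one_in_lower_central[of "Suc n"] by auto
qed

lemma lower_central_Suc_trivial:
  assumes "lower_central G n \<subseteq> centre G"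
  shows "lower_central G (Suc n) = {\<one>}"
proof -
  have "lower_central G (Suc n) \<subseteq> {\<one>}" unfolding lower_central.simps
  proof (rule commutator_subgroup_subset[OF triv_subgroup])
    fix h k assume "h \<in> lower_central G n" "k \<in> carrier G"
    then have "h \<in> centre G" using assms by blast
    then show "commutator h k \<in> {\<one>}"
      using \<open>k \<in> carrier G\<close> centreD[of h k] by (simp add: commutator_eq_one)
  qed
  then show ?thesis using one_in_lower_central by blast
qed

section \<open>Powers of products whose commutator is central\<close>

lemma pow_central_commutator:
  assumes [simp]: "x \<in> carrier G" "y \<in> carrier G" and z: "commutator y x \<in> centre G"
  shows "y [^] (n::nat) \<otimes> x = x \<otimes> y [^] n \<otimes> commutator y x [^] n"
proof (induction n)
  case (Suc n)
  let ?z = "commutator y x"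
  have "y [^] Suc n \<otimes> x = y [^] n \<otimes> (y \<otimes> x)" by (simp add: m_assoc)
  also have "y \<otimes> x = x \<otimes> y \<otimes> ?z"
    using commutator_swap[of y x] centreD[OF z, of "x \<otimes> y"] by simp
  also have "y [^] n \<otimes> (x \<otimes> y \<otimes> ?z) = (y [^] n \<otimes> x) \<otimes> (y \<otimes> ?z)" by (simp add: m_assoc)
  also have "\<dots> = x \<otimes> y [^] n \<otimes> ?z [^] n \<otimes> (y \<otimes> ?z)" by (simp add: Suc)
  also have "\<dots> = x \<otimes> y [^] n \<otimes> ((?z [^] n \<otimes> y) \<otimes> ?z)" by (simp add: m_assoc)
  also have "?z [^] n \<otimes> y = y \<otimes> ?z [^] n"
    using centreD[OF z, of y] group_commutes_pow[of ?z y] by simp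
  finally show ?case by (simp add: m_assoc)
qed simp

text \<open>Appending one more factor x y moves x to the left past y^n, which costs n copies of the
  commutator; these costs add up to n choose 2.\<close>

lemma pow_mult_central_commutator:
  assumes [simp]: "x \<in> carrier G" "y \<in> carrier G" and z: "commutator y x \<in> centre G"
  shows "(x \<otimes> y) [^] (n::nat) = x [^] n \<otimes> y [^] n \<otimes> commutator y x [^] (\<Sum>i<n. i)"
proof (induction n)
  case (Suc n)
  let ?z = "commutator y x" and ?s = "\<Sum>i<n. i"
  have c: "?z [^] i \<otimes> g = g \<otimes> ?z [^] i" if "g \<in> carrier G" for g and i :: nat
    using centreD[OF z that] group_commutes_pow[of ?z g] that by simp
  have "(x \<otimes> y) [^] Suc n = x [^] n \<otimes> y [^] n \<otimes> (?z [^] ?s \<otimes> (x \<otimes> y))"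
    by (simp add: Suc m_assoc)
  also have "\<dots> = x [^] n \<otimes> ((y [^] n \<otimes> x) \<otimes> y \<otimes> ?z [^] ?s)"
    by (subst c) (simp_all add: m_assoc)
  also have "\<dots> = x [^] n \<otimes> (x \<otimes> y [^] n \<otimes> (?z [^] n \<otimes> y) \<otimes> ?z [^] ?s)"
    by (simp add: pow_central_commutator[OF _ _ z] m_assoc)
  also have "\<dots> = x [^] n \<otimes> (x \<otimes> y [^] n \<otimes> (y \<otimes> ?z [^] n) \<otimes> ?z [^] ?s)"
    by (subst c) simp_all
  also have "\<dots> = x [^] Suc n \<otimes> y [^] Suc n \<otimes> (?z [^] n \<otimes> ?z [^] ?s)"
    by (simp add: m_assoc)
  finally show ?case by (simp add: nat_pow_mult add.commute)
qed simp

text \<open>For odd p the correction exponent p(p - 1)/2 is a multiple of p, so the correction is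
  trivial. Both the choice of an element of order p outside D and the normality of A^p rest on
  this.\<close>

lemma odd_pow_mult_distrib:
  assumes xy: "x \<in> carrier G" "y \<in> carrier G" and z: "commutator y x \<in> centre G"
    and p: "odd p" "commutator y x [^] p = \<one>"
  shows "(x \<otimes> y) [^] (p::nat) = x [^] p \<otimes> y [^] p"
proof -
  obtain q where q: "p = Suc (2 * q)" using p(1) oddE by fastforce
  have "(\<Sum>i<Suc n. i) * 2 = Suc n * n" for n :: nat
    by (induction n) (auto simp: algebra_simps)
  from this[of "2 * q"] have "(\<Sum>i<p. i) = p * q"
    unfolding q by simp
  then have "commutator y x [^] (\<Sum>i<p. i) = \<one>"
    using xy p(2) by (simp flip: nat_pow_pow)
  then show ?thesis using pow_mult_central_commutator[OF xy z, of p] xy by simp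
qed

end

section \<open>Finite p-groups\<close>

locale p_group = group G for G (structure) +
  fixes p :: nat
  assumes prime_p: "Factorial_Ring.prime p"
    and finite_carrier: "finite (carrier G)"
    and order_power: "\<exists>n. order G = p ^ n"
begin

lemma p_gt_1: "p > 1"
  using prime_p prime_gt_1_nat by blast

lemma card_subgroup:
  assumes "subgroup H G"
  obtains k where "card H = p ^ k"
  using lagrange[OF assms] order_power prime_p
  by (metis divides_primepow_nat dvd_triv_right)

lemma ord_power:
  assumes "x \<in> carrier G"
  obtains k where "ord x = p ^ k"
  using card_subgroup[of "generate G {x}"] assms
  by (metis generate_is_subgroup generate_pow_card empty_subsetI insert_subset)

lemma generate_singleton:
  assumes "x \<in> carrier G"
  shows "generate G {x} = {x [^] (k :: nat) | k. True}"
  using generate_pow_on_finite_carrier[OF finite_carrier assms] by simp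

lemma subgroup_generate_singleton:
  "x \<in> carrier G \<Longrightarrow> subgroup (generate G {x}) G"
  by (simp add: generate_is_subgroup)

lemma finite_subgroup: "subgroup H G \<Longrightarrow> finite H"
  using finite_carrier subgroup.subset finite_subset by blast

lemma proper_subgroup_card:
  assumes "subgroup A G" "subgroup K G" "A \<subset> K"
  shows "p * card A \<le> card K"
proof -
  obtain a b where "card A = p ^ a" "card K = p ^ b"
    using card_subgroup assms(1,2) by metis
  moreover have "card A < card K"
    using assms finite_subgroup psubset_card_mono by blast
  ultimately have "Suc a \<le> b"
    using p_gt_1 by (simp add: Suc_le_eq)
  then have "p ^ Suc a \<le> p ^ b" using p_gt_1 by (intro power_increasing) auto
  then show ?thesis using \<open>card A = p ^ a\<close> \<open>card K = p ^ b\<close> by simp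
qed

text \<open>Subgroup orders are powers of p, so a subgroup of index at most p has nothing strictly
  between itself and the group. The role of K is played by centralizers below.\<close>

lemma proper_supergroup_eq_carrier:
  assumes "subgroup A G" "subgroup K G" "A \<subset> K" "order G \<le> p * card A"
  shows "K = carrier G"
  using proper_subgroup_card[OF assms(1-3)] assms finite_carrier subgroup.subset[OF assms(2)]
  unfolding order_def by (intro card_seteq) auto

lemma nontrivial_subgroup_card:
  assumes "subgroup H G" "H \<noteq> {\<one>}"
  shows "p dvd card H"
proof -
  have "card H \<noteq> 1"
    using assms subgroup.one_closed[OF assms(1)] by (metis card_1_singletonE singletonD)
  then show ?thesis using card_subgroup[OF assms(1)]
    by (metis dvd_power neq0_conv power_0)
qed

text \<open>Class equation inside N: the class of a noncentral element of N stays in N, and its size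
  is a power of p other than 1. So p divides the number of noncentral elements of N as well as the
  order of N, and hence the order of the intersection with the centre.\<close>

lemma normal_meets_centre:
  assumes N: "N \<lhd> G" "N \<noteq> {\<one>}"
  shows "N \<inter> centre G \<noteq> {\<one>}"
proof
  assume triv: "N \<inter> centre G = {\<one>}"
  let ?\<phi> = "\<lambda>g. \<lambda>h\<in>carrier G. g \<otimes> h \<otimes> inv g"
  interpret act: group_action G "carrier G" ?\<phi> by (rule action_by_conjugation)
  have sub: "subgroup N G" using N(1) normal_imp_subgroup by blast
  then have NG: "N \<subseteq> carrier G" by (rule subgroup.subset)
  have orb: "orbit G ?\<phi> x = {g \<otimes> x \<otimes> inv g | g. g \<in> carrier G}" if "x \<in> carrier G" for x
    using that unfolding orbit_def by auto
  define C where "C = orbit G ?\<phi> ` (N - centre G)"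
  have sub_N: "orbit G ?\<phi> x \<subseteq> N - centre G" if "x \<in> N - centre G" for x
  proof
    fix y assume y: "y \<in> orbit G ?\<phi> x"
    obtain g where g: "g \<in> carrier G" "y = g \<otimes> x \<otimes> inv g"
    proof -
      have "x \<in> carrier G" using \<open>x \<in> N - centre G\<close> NG by auto
      from orb[OF this] y that show thesis by auto
    qed
    have "x = inv g \<otimes> y \<otimes> inv (inv g)"
      using g that NG by (simp add: m_assoc subset_iff) (simp flip: m_assoc)
    moreover have "y \<in> N" using g that N(1) by (simp add: normal_inv_iff)
    ultimately show "y \<in> N - centre G"
      using that g(1) normal_invE(2)[OF centre_normal, of "inv g" y] by auto
  qed
  have self: "x \<in> orbit G ?\<phi> x" if "x \<in> carrier G" for x
    by (rule act.orbit_refl[OF that])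
  have U: "\<Union> C = N - centre G"
    unfolding C_def using sub_N self NG by blast
  have "p dvd card (\<Union> C)"
  proof (rule dvd_partition)
    show "finite (\<Union> C)" unfolding U using finite_subgroup[OF sub] by simp
    show "\<forall>c\<in>C. p dvd card c"
    proof
      fix c assume "c \<in> C"
      then obtain x where x: "x \<in> N" "x \<notin> centre G" "c = orbit G ?\<phi> x"
        unfolding C_def by blast
      then have xG: "x \<in> carrier G" using NG by blast
      have "card c dvd order G"
        unfolding x(3) using act.orbit_stabilizer_theorem[OF xG] by (rule dvdI[OF sym])
      then obtain k where k: "card c = p ^ k"
        using order_power prime_p divides_primepow_nat by metis
      obtain g where g: "g \<in> carrier G" "x \<otimes> g \<noteq> g \<otimes> x"
        using x(2) xG unfolding centre_def by auto
      have "g \<otimes> x \<otimes> inv g \<noteq> x"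
        using g xG by (metis inv_solve_right m_closed)
      moreover have "g \<otimes> x \<otimes> inv g \<in> c" "x \<in> c"
        using x(3) g(1) self[OF xG] orb[OF xG] by auto
      ultimately have "card c \<noteq> 1" by (metis card_1_singletonE singletonD)
      then show "p dvd card c" using k by (metis dvd_power neq0_conv power_0)
    qed
    show "\<forall>c1\<in>C. \<forall>c2\<in>C. c1 \<noteq> c2 \<longrightarrow> c1 \<inter> c2 = {}"
      using act.disjoint_union NG unfolding C_def orbits_def by blast
  qed
  moreover have "card N = card (N - centre G) + card (N \<inter> centre G)"
    using finite_subgroup[OF sub] by (metis card_Diff_subset_Int card_Int_Diff add.commute finite_Int)
  ultimately have "p dvd card (N \<inter> centre G)"
    using nontrivial_subgroup_card[OF sub N(2)] U by (metis dvd_add_right_iff)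
  then show False using triv p_gt_1 by simp
qed

text \<open>If N is nontrivial, its intersection with the centre already has order at least p, which
  leaves no room for other elements.\<close>

lemma small_normal_central:
  assumes N: "N \<lhd> G" "card N \<le> p"
  shows "N \<subseteq> centre G"
proof (cases "N = {\<one>}")
  case True
  then show ?thesis using subgroup.one_closed[OF subgroup_centre] by simp
next
  case False
  have sub: "subgroup N G" using N(1) normal_imp_subgroup by blast
  have "p dvd card (N \<inter> centre G)"
    using nontrivial_subgroup_card[OF subgroups_Inter_pair[OF sub subgroup_centre]]
      normal_meets_centre[OF N(1) False] by blast
  moreover have "finite N" by (rule finite_subgroup[OF sub])
  moreover have "card (N \<inter> centre G) \<noteq> 0"
    using \<open>finite N\<close> subgroup.one_closed[OF sub] subgroup.one_closed[OF subgroup_centre] by auto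
  ultimately have "card N \<le> card (N \<inter> centre G)"
    using N(2) dvd_imp_le[of p "card (N \<inter> centre G)"] by linarith
  then show ?thesis using \<open>finite N\<close> by (metis Int_lower1 Int_lower2 card_seteq)
qed

text \<open>If x has order p^m and (x^k)^p = 1, then p^(m-1) divides k, so all such elements lie in
  the subgroup generated by x^(p^(m-1)), of order at most p. For m = 0 truncated subtraction makes
  that generator x itself, which is then trivial.\<close>

lemma card_exponent_p_le:
  assumes x: "x \<in> carrier G" and U: "U \<subseteq> generate G {x}" "\<And>y. y \<in> U \<Longrightarrow> y [^] p = \<one>"
  shows "card U \<le> p"
proof -
  obtain m where m: "ord x = p ^ m" using ord_power[OF x] .
  have gen: "y \<in> generate G {x [^] (p ^ (m - 1))}" if "y \<in> U" for y
  proof -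
    obtain k :: nat where k: "y = x [^] k" 
    proof -
      have "y \<in> generate G {x}" using \<open>y \<in> U\<close> U(1) by (rule set_rev_mp)
      then show thesis using that generate_singleton[OF x] by auto
    qed
    have "x [^] (k * p) = \<one>" using U(2)[OF that] k x by (simp add: nat_pow_pow)
    then have "p ^ m dvd k * p" using m pow_eq_id[OF x] by simp
    then have "p ^ (m - 1) dvd k" using p_gt_1 by (cases m) auto
    then obtain j where "k = p ^ (m - 1) * j" by blast
    then have "y = (x [^] (p ^ (m - 1))) [^] j" using k x by (simp add: nat_pow_pow)
    then show ?thesis using generate_singleton[of "x [^] (p ^ (m - 1))"] x by auto
  qed
  have "(x [^] (p ^ (m - 1))) [^] p = \<one>"
    using pow_eq_id[OF x] m x by (cases m) (auto simp: nat_pow_pow mult.commute)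
  then have "ord (x [^] (p ^ (m - 1))) dvd p"
    using pow_eq_id x by simp
  then have "card (generate G {x [^] (p ^ (m - 1))}) \<le> p"
    using generate_pow_card[of "x [^] (p ^ (m - 1))"] x p_gt_1 by (simp add: dvd_imp_le)
  moreover have "card U \<le> card (generate G {x [^] (p ^ (m - 1))})"
    using gen x by (intro card_mono finite_subgroup subgroup_generate_singleton) auto
  ultimately show ?thesis by linarith
qed

end

section \<open>Quotient homomorphisms\<close>

text \<open>A quotient is given by an epimorphism with kernel N and not as \<open>G Mod N\<close>,
  so that any isomorphic copy of it can serve.\<close>

locale quotient_hom = group_hom G H h for G (structure) and H (structure) and h +
  fixes N
  assumes surj: "h ` carrier G = carrier H"
    and ker: "x \<in> carrier G \<Longrightarrow> h x = \<one>\<^bsub>H\<^esub> \<longleftrightarrow> x \<in> N"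
    and N_sub: "N \<subseteq> carrier G"
begin

lemma hom_commutator:
  "x \<in> carrier G \<Longrightarrow> y \<in> carrier G \<Longrightarrow> h (G.commutator x y) = H.commutator (h x) (h y)"
  by (simp add: G.commutator_def H.commutator_def)

lemma image_lower_central: "lower_central H n = h ` lower_central G n"
proof (induction n)
  case (Suc n)
  let ?K = "\<Union>x\<in>lower_central G n. \<Union>y\<in>carrier G. {G.commutator x y}"
  have sub: "lower_central G n \<subseteq> carrier G" by (rule G.lower_central_carrier)
  have "lower_central H (Suc n)
      = generate H (\<Union>x\<in>h ` lower_central G n. \<Union>y\<in>h ` carrier G. {H.commutator x y})"
    by (simp add: commutator_subgroup_def Suc surj H.commutator_def)
  also have "(\<Union>x\<in>h ` lower_central G n. \<Union>y\<in>h ` carrier G. {H.commutator x y}) = h ` ?K"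
  proof -
    have "(\<Union>x\<in>h ` lower_central G n. \<Union>y\<in>h ` carrier G. {H.commutator x y})
        = (\<Union>x\<in>lower_central G n. \<Union>y\<in>carrier G. {H.commutator (h x) (h y)})"
      by simp
    also have "\<dots> = (\<Union>x\<in>lower_central G n. \<Union>y\<in>carrier G. {h (G.commutator x y)})"
      using sub by (intro SUP_cong refl) (simp add: hom_commutator subset_iff)
    also have "\<dots> = h ` ?K" by blast
    finally show ?thesis .
  qed
  also have "generate H (h ` ?K) = h ` generate G ?K"
    by (rule generate_img) (use sub in auto)
  also have "generate G ?K = lower_central G (Suc n)"
    by (simp add: commutator_subgroup_def G.commutator_def)
  finally show ?case .
qed (simp add: surj)

lemma lower_central_subset_kernel:
  "lower_central H n = {\<one>\<^bsub>H\<^esub>} \<Longrightarrow> lower_central G n \<subseteq> N"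
  using image_lower_central[of n] G.lower_central_carrier[of n] ker by blast

lemma card_preimage:
  assumes fin: "finite (carrier G)" and K: "K \<subseteq> carrier H"
  shows "card {x \<in> carrier G. h x \<in> K} = card N * card K"
proof -
  have finK: "finite K" using fin K surj by (metis finite_imageI finite_subset)
  have fibre: "card {x \<in> carrier G. h x = k} = card N" if "k \<in> K" for k
  proof -
    obtain g where g: "g \<in> carrier G" "k = h g"
    proof -
      have "k \<in> h ` carrier G" using \<open>k \<in> K\<close> K surj by auto
      then show thesis using that by (elim imageE)
    qed
    have "bij_betw (\<lambda>n. n \<otimes> g) N {x \<in> carrier G. h x = k}"
    proof (rule bij_betwI[where g = "\<lambda>x. x \<otimes> inv g"])
      show "(\<lambda>n. n \<otimes> g) \<in> N \<rightarrow> {x \<in> carrier G. h x = k}"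
        using g N_sub ker by auto
      show "(\<lambda>x. x \<otimes> inv g) \<in> {x \<in> carrier G. h x = k} \<rightarrow> N"
        using g by (auto simp flip: ker)
    qed (use g N_sub in \<open>auto simp: G.m_assoc\<close>)
    then show ?thesis by (metis bij_betw_same_card)
  qed
  have "{x \<in> carrier G. h x \<in> K} = (\<Union>k\<in>K. {x \<in> carrier G. h x = k})" by auto
  then have "card {x \<in> carrier G. h x \<in> K} = (\<Sum>k\<in>K. card {x \<in> carrier G. h x = k})"
    using finK fin by (simp only:) (rule card_UN_disjoint, auto)
  then show ?thesis using fibre by simp
qed

lemma order_kernel: "finite (carrier G) \<Longrightarrow> order G = card N * order H"
proof -
  assume "finite (carrier G)"
  moreover have "{x \<in> carrier G. h x \<in> carrier H} = carrier G" by auto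
  ultimately show ?thesis using card_preimage[of "carrier H"] by (simp add: order_def)
qed

lemma p_group_quotient:
  assumes "p_group G p"
  shows "p_group H p"
proof -
  interpret p_group G p by fact
  have "finite (carrier H)" using finite_carrier surj by (metis finite_imageI)
  moreover have "order H dvd order G" using order_kernel[OF finite_carrier] by simp
  then have "\<exists>n. order H = p ^ n"
    using order_power prime_p divides_primepow_nat by metis
  ultimately show ?thesis using prime_p by unfold_locales auto
qed

end

(* Quotients are represented on the carrier type nat, so that an induction through them stays in one type. *)
lemma (in group) quotient_hom_exists:
  assumes fin: "finite (carrier G)" and N: "N \<lhd> G"
  obtains H :: "nat monoid" and h where "quotient_hom G H h N"
proof -
  let ?Q = "G Mod N"
  interpret N: normal N G by fact
  interpret Q: group ?Q by (rule N.factorgroup_is_group)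
  interpret pr: group_hom G ?Q "\<lambda>a. N #> a"
    by unfold_locales (rule N.r_coset_hom_Mod)
  have surj: "(\<lambda>a. N #> a) ` carrier G = carrier ?Q"
    by (auto simp: FactGroup_def RCOSETS_def)
  then have "finite (carrier ?Q)" using fin by (metis finite_imageI)
  then obtain e where e: "bij_betw e (carrier ?Q) {0..<card (carrier ?Q)}"
    using ex_bij_betw_finite_nat by blast
  define d where "d = the_inv_into (carrier ?Q) e"
  have de: "d (e x) = x" if "x \<in> carrier ?Q" for x
    using e that unfolding d_def by (simp add: bij_betw_def the_inv_into_f_f)
  \<comment> \<open>The multiplication of \<open>G Mod N\<close> is transported along the numbering
    \<open>e\<close> of the cosets, with \<open>d\<close> as decoder.\<close>
  define H where "H = \<lparr>carrier = e ` carrier ?Q, monoid.mult = (\<lambda>a b. e (d a \<otimes>\<^bsub>?Q\<^esub> d b)), one = e \<one>\<^bsub>?Q\<^esub>\<rparr>"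
  have "group H"
  proof (rule groupI)
    fix x assume "x \<in> carrier H"
    then obtain a where a: "a \<in> carrier ?Q" "x = e a" unfolding H_def by auto
    then show "\<exists>y\<in>carrier H. y \<otimes>\<^bsub>H\<^esub> x = \<one>\<^bsub>H\<^esub>"
      using Q.l_inv[OF a(1)] Q.inv_closed[OF a(1)]
      by (intro bexI[of _ "e (inv\<^bsub>?Q\<^esub> a)"]) (simp_all add: H_def de del: mult_FactGroup one_FactGroup)
  qed (auto simp: H_def de Q.m_assoc simp del: mult_FactGroup one_FactGroup)
  moreover have "e \<in> hom ?Q H" unfolding H_def hom_def
    by (auto simp: de simp del: mult_FactGroup)
  ultimately have "group_hom G H (\<lambda>a. e (N #> a))"
    using Group.hom_compose[OF N.r_coset_hom_Mod] is_group
    unfolding group_hom_def group_hom_axioms_def comp_def by auto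
  moreover have "(\<lambda>a. e (N #> a)) ` carrier G = carrier H"
    unfolding H_def by (simp flip: surj add: image_image)
  moreover have "e (N #> x) = \<one>\<^bsub>H\<^esub> \<longleftrightarrow> x \<in> N" if "x \<in> carrier G" for x
  proof -
    have "e (N #> x) = \<one>\<^bsub>H\<^esub> \<longleftrightarrow> N #> x = \<one>\<^bsub>?Q\<^esub>"
      using inj_on_eq_iff[OF bij_betw_imp_inj_on[OF e] pr.hom_closed[OF that] Q.one_closed]
      unfolding H_def by (simp only: monoid.simps)
    also have "\<dots> \<longleftrightarrow> x \<in> N"
      using coset_join1[OF _ that N.subgroup_axioms] coset_join2[OF that N.subgroup_axioms] by auto
    finally show ?thesis .
  qed
  ultimately have "quotient_hom G H (\<lambda>a. e (N #> a)) N"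
    unfolding quotient_hom_def quotient_hom_axioms_def using N.subset by auto
  then show thesis by (rule that)
qed

section \<open>A noncyclic normal subgroup close to the centre\<close>

context group
begin

lemma conj_pow:
  assumes "y \<in> carrier G" "x \<in> carrier G"
  shows "(y \<otimes> x \<otimes> inv y) [^] (n :: nat) = y \<otimes> x [^] n \<otimes> inv y"
proof (induction n)
  case (Suc n)
  have "inv y \<otimes> (y \<otimes> z) = z" if "z \<in> carrier G" for z
    using assms that by (simp flip: m_assoc)
  with Suc assms show ?case by (simp add: m_assoc)
qed (use assms in simp)

lemma pow_cong_ord:
  assumes "x \<in> carrier G" "[a = b] (mod ord x)"
  shows "x [^] (a :: nat) = x [^] b"
proof -
  have "int (ord x) dvd int b - int a"
    using assms(2) by (metis cong_iff_dvd_diff cong_int_iff cong_sym)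
  then have "x [^] int a = x [^] int b" using int_pow_eq[OF assms(1)] by blast
  then show ?thesis by (simp add: int_pow_int)
qed

end

context p_group
begin

lemma normal_generate_singleton:
  assumes x: "x \<in> carrier G" and conj: "\<And>y. y \<in> carrier G \<Longrightarrow> y \<otimes> x \<otimes> inv y \<in> generate G {x}"
  shows "generate G {x} \<lhd> G"
proof (rule normal_invI)
  show sub: "subgroup (generate G {x}) G" by (rule subgroup_generate_singleton[OF x])
  fix y n assume y: "y \<in> carrier G" and "n \<in> generate G {x}"
  then obtain k :: nat where "n = x [^] k" using generate_singleton[OF x] by auto
  then have "y \<otimes> n \<otimes> inv y = (y \<otimes> x \<otimes> inv y) [^] k" using conj_pow[OF y x] by simp
  moreover obtain j :: nat where "y \<otimes> x \<otimes> inv y = x [^] j"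
    using conj[OF y] generate_singleton[OF x] by auto
  ultimately have "y \<otimes> n \<otimes> inv y = x [^] (j * k)" using x by (simp add: nat_pow_pow)
  then show "y \<otimes> n \<otimes> inv y \<in> generate G {x}" using generate_singleton[OF x] by auto
qed

lemma central_of_order_p:
  assumes "carrier G \<noteq> {\<one>}"
  obtains w where "w \<in> centre G" "w \<noteq> \<one>" "w [^] p = \<one>"
proof -
  have "carrier G \<inter> centre G \<noteq> {\<one>}" using normal_meets_centre[OF normal_self assms] .
  moreover have "\<one> \<in> centre G" using subgroup.one_closed[OF subgroup_centre] .
  ultimately obtain z where z: "z \<in> centre G" "z \<noteq> \<one>" by auto
  then have zG: "z \<in> carrier G" by simp
  obtain r where r: "ord z = p ^ r" using ord_power[OF zG] .
  with r z(2) zG have "r \<noteq> 0" by (metis ord_eq_1 power_0)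
  then obtain s where s: "r = Suc s" by (cases r) auto
  define w where "w = z [^] (p ^ s)"
  have "w \<otimes> g = g \<otimes> w" if "g \<in> carrier G" for g
    unfolding w_def using group_commutes_pow[OF centreD[OF z(1) that] zG that] .
  then have "w \<in> centre G" unfolding centre_def by (intro CollectI conjI ballI) (use zG in \<open>simp add: w_def\<close>)
  moreover have "w \<noteq> \<one>" unfolding w_def using pow_eq_id[OF zG] r s p_gt_1
    by (auto dest: dvd_imp_le)
  moreover have "w [^] p = \<one>" unfolding w_def using pow_eq_id[OF zG] r s zG
    by (simp add: nat_pow_pow mult.commute)
  ultimately show thesis by (rule that)
qed

text \<open>N will consist of the products f^i u, where f^p = 1, f lies outside a largest normal
  cyclic D, and u runs over the subgroup U of elements of D killed by p. As U is central, it is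
  enough that conjugation changes f only by factors from U.\<close>

lemma exists_normal_not_in_cyclic:
  assumes odd_p: "odd p" and noncyclic: "\<And>x. x \<in> carrier G \<Longrightarrow> generate G {x} \<noteq> carrier G"
  obtains N where "N \<lhd> G" "\<And>n. n \<in> N \<Longrightarrow> n [^] p = \<one>"
    "\<And>n y. n \<in> N \<Longrightarrow> y \<in> carrier G \<Longrightarrow> commutator n y \<in> centre G"
    "\<And>a. a \<in> carrier G \<Longrightarrow> \<not> N \<subseteq> generate G {a}"
proof -
  define X where "X = {d \<in> carrier G. generate G {d} \<lhd> G}"
  have "finite X" "\<one> \<in> X"
    unfolding X_def using finite_carrier one_is_normal by (auto simp: generate_one)
  then have "Max (ord ` X) \<in> ord ` X" "\<And>x. x \<in> X \<Longrightarrow> ord x \<le> Max (ord ` X)"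
    by (auto intro: Max_in)
  then obtain d where "d \<in> X" and max: "\<And>x. x \<in> X \<Longrightarrow> ord x \<le> ord d" by force
  define D where "D = generate G {d}"
  have d: "d \<in> carrier G" and DN: "D \<lhd> G" using \<open>d \<in> X\<close> unfolding X_def D_def by auto
  interpret D: normal D G by (rule DN)
  have D_eq: "D = {d [^] (k :: nat) | k. True}" unfolding D_def by (rule generate_singleton[OF d])
  have dD: "d \<in> D" unfolding D_def by (simp add: generate.incl)
  have D_comm: "a \<otimes> b = b \<otimes> a" if "a \<in> D" "b \<in> D" for a b
    using that d unfolding D_eq by (auto simp: nat_pow_mult add.commute)
  obtain H :: "nat monoid" and h where "quotient_hom G H h D"
    using quotient_hom_exists[OF finite_carrier DN] .
  then interpret H: p_group H p by (rule quotient_hom.p_group_quotient) (rule p_group_axioms)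
  interpret q: quotient_hom G H h D by fact
  have "D \<noteq> carrier G" using noncyclic[OF d] unfolding D_def .
  then obtain y where "y \<in> carrier G" "y \<notin> D" using D.subset by blast
  then have "h y \<in> carrier H" "h y \<noteq> \<one>\<^bsub>H\<^esub>" using q.ker by auto
  then have "carrier H \<noteq> {\<one>\<^bsub>H\<^esub>}" by blast
  then obtain w where w: "w \<in> centre H" "w \<noteq> \<one>\<^bsub>H\<^esub>" "w [^]\<^bsub>H\<^esub> p = \<one>\<^bsub>H\<^esub>"
    using H.central_of_order_p by blast
  then have "w \<in> h ` carrier G" using q.surj H.centre_carrier by simp
  then obtain g where g: "g \<in> carrier G" and hg: "h g = w" by auto
  have gD: "g \<notin> D" using q.ker[OF g] hg w(2) by simp
  have gpD: "g [^] p \<in> D" using q.ker[of "g [^] p"] q.hom_nat_pow[OF g] g hg w(3) by simp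
  have comm_D: "commutator x y \<in> D"
    if "x \<in> carrier G" "y \<in> carrier G" "h x \<in> centre H \<or> h y \<in> centre H" for x y
  proof -
    have "h x \<otimes>\<^bsub>H\<^esub> h y = h y \<otimes>\<^bsub>H\<^esub> h x"
      using that H.centreD[of "h x" "h y"] H.centreD[of "h y" "h x"] q.hom_closed by metis
    then have "h (commutator x y) = \<one>\<^bsub>H\<^esub>"
      using that by (simp add: q.hom_commutator H.commutator_eq_one)
    then show ?thesis using q.ker that by simp
  qed
  \<comment> \<open>Otherwise the subgroup generated by g contains D properly. It also contains
    every commutator with g, since these lie in D; so it is normal, against the choice of d.\<close>
  have d_notin: "d \<notin> generate G {g}"
  proof
    assume "d \<in> generate G {g}"
    then have D_le: "D \<subseteq> generate G {g}"
      unfolding D_def using subgroup_generate_singleton[OF g] by (intro generate_subgroup_incl) auto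
    have sub: "subgroup (generate G {g}) G" by (rule subgroup_generate_singleton[OF g])
    have "generate G {g} \<lhd> G"
    proof (rule normal_generate_singleton[OF g])
      fix y assume y: "y \<in> carrier G"
      have "commutator y g \<in> generate G {g}" using comm_D[OF y g] hg w(1) D_le by auto
      then show "y \<otimes> g \<otimes> inv y \<in> generate G {g}"
        using conj_eq_commutator_mult[OF y g] subgroup.m_closed[OF sub]
        by (simp add: generate.incl)
    qed
    then have "ord g \<le> ord d" using max g unfolding X_def by simp
    moreover have "D \<subset> generate G {g}" using D_le gD generate.incl[of g "{g}" G] by auto
    then have "card D < card (generate G {g})"
      using finite_subgroup[OF sub] by (rule psubset_card_mono[rotated])
    ultimately show False
      using generate_pow_card[OF g] generate_pow_card[OF d] unfolding D_def by simp
  qed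
  have "d \<noteq> \<one>" using d_notin by (metis generate.one)
  obtain m where "ord d = p ^ m" using ord_power[OF d] .
  with \<open>ord d = p ^ m\<close> \<open>d \<noteq> \<one>\<close> d have "m \<noteq> 0" by (metis ord_eq_1 power_0)
  then obtain l where l: "ord d = p ^ Suc l" using \<open>ord d = p ^ m\<close> by (cases m) auto
  \<comment> \<open>Write g^p = d^i. If p did not divide i, then d^i would generate D and d would be
    a power of g. So g^p has a p-th root e in D, by which g can be corrected.\<close>
  obtain e where e: "e \<in> D" "e [^] p = g [^] p"
  proof -
    obtain i :: nat where i: "g [^] p = d [^] i" using gpD unfolding D_eq by auto
    have "p dvd i"
    proof (rule ccontr)
      assume "\<not> p dvd i"
      then have "coprime i (p ^ Suc l)"
        using prime_p by (meson coprime_commute coprime_power_right_iff prime_imp_coprime)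
      then obtain j where "[i * j = Suc 0] (mod p ^ Suc l)"
        using cong_solve_coprime_nat by blast
      then have "d [^] (i * j) = d [^] Suc 0" using pow_cong_ord[OF d] l by simp
      then have "d = (g [^] p) [^] j" using i d by (simp add: nat_pow_pow)
      then have "d = g [^] (p * j)" using g by (simp add: nat_pow_pow)
      then show False using d_notin generate_singleton[OF g] by auto
    qed
    then obtain j where "i = p * j" by blast
    then have "(d [^] j) [^] p = g [^] p" using i d by (simp add: nat_pow_pow mult.commute)
    then show thesis using that[of "d [^] j"] unfolding D_eq by auto
  qed
  \<comment> \<open>This is Omega_1 of the cyclic group D: characteristic in D, hence normal in G,
    and of order at most p, hence central.\<close>
  define U where "U = {x \<in> D. x [^] p = \<one>}"
  have UD: "U \<subseteq> D" unfolding U_def by auto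
  have UG: "U \<subseteq> carrier G" using UD D.subset by auto
  have subU: "subgroup U G"
  proof (rule subgroupI)
    show "U \<noteq> {}" unfolding U_def using D.one_closed nat_pow_one by blast
  next
    fix a assume "a \<in> U"
    then show "inv a \<in> U" unfolding U_def using D.subset by (auto simp: nat_pow_inv)
  next
    fix a b assume "a \<in> U" "b \<in> U"
    then have ab: "a \<in> D" "b \<in> D" "a [^] p = \<one>" "b [^] p = \<one>" unfolding U_def by auto
    then show "a \<otimes> b \<in> U"
      unfolding U_def using D.subset pow_mult_distrib[OF D_comm[OF ab(1,2)]] by auto
  qed (rule UG)
  interpret U: subgroup U G by (rule subU)
  have "U \<lhd> G"
  proof (rule normal_invI[OF subU])
    fix y x assume y: "y \<in> carrier G" "x \<in> U"
    then have "(y \<otimes> x \<otimes> inv y) [^] p = \<one>"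
      using conj_pow[of y x p] UG unfolding U_def by auto
    then show "y \<otimes> x \<otimes> inv y \<in> U"
      using normal_invE(2)[OF DN, of y x] y UD unfolding U_def by auto
  qed
  moreover have "card U \<le> p"
    by (rule card_exponent_p_le[OF d]) (use UD in \<open>auto simp: D_def U_def\<close>)
  ultimately have UZ: "U \<subseteq> centre G" by (rule small_normal_central)
  \<comment> \<open>Conjugation by g sends d to d^k. As g^p lies in the abelian group D, k^p = 1
    modulo p^(l+1), the order of d; the congruence lemma yields k = 1 modulo p^l. So the commutator
    d^(1-k) is killed by p. Exponents are integers here because 1 - k may be negative.\<close>
  have gdU: "commutator d g \<in> U"
  proof -
    have "g \<otimes> d \<otimes> inv g \<in> D" using normal_invE(2)[OF DN g dD] .
    then obtain k :: nat where k: "g \<otimes> d \<otimes> inv g = d [^] k" unfolding D_eq by auto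
    have iter: "g [^] j \<otimes> d \<otimes> inv (g [^] j) = d [^] (k ^ j)" for j :: nat
    proof (induction j)
      case (Suc j)
      have "g [^] Suc j \<otimes> d \<otimes> inv (g [^] Suc j) = g [^] j \<otimes> (g \<otimes> d \<otimes> inv g) \<otimes> inv (g [^] j)"
        using g d by (simp add: inv_mult_group m_assoc)
      also have "\<dots> = (g [^] j \<otimes> d \<otimes> inv (g [^] j)) [^] k"
        unfolding k using g d by (simp add: conj_pow)
      finally show ?case using Suc d by (simp add: nat_pow_pow mult.commute)
    qed (use d in simp)
    have "g [^] p \<otimes> d \<otimes> inv (g [^] p) = d"
      using D_comm[OF gpD dD] g d by (simp add: m_assoc)
    then have "d [^] int (k ^ p) = d [^] (1 :: int)" using iter[of p] d by (simp only: int_pow_int int_pow_1)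
    then have "int (ord d) dvd 1 - int (k ^ p)" by (subst (asm) int_pow_eq[OF d])
    then have "int p ^ Suc l dvd int k ^ p - 1" using l by (metis dvd_diff_commute of_nat_power of_nat_id)
    then have "int p ^ l dvd int k - 1" by (rule prime_power_dvd_diff_one[OF prime_p odd_p])
    then have dv: "int (ord d) dvd (1 - int k) * int p"
      unfolding l using dvd_diff_commute[of "int p ^ l" 1 "int k"] by (simp add: mult.commute mult_dvd_mono)
    have "commutator d g = d \<otimes> inv (d [^] k)"
      unfolding k[symmetric] commutator_def using g d by (simp add: inv_mult_group m_assoc)
    also have "\<dots> = d [^] (1 - int k)" using d by (simp add: int_pow_diff int_pow_int)
    finally have c: "commutator d g = d [^] (1 - int k)" .
    then have "commutator d g [^] p = (d [^] (1 - int k)) [^] int p" by (simp add: int_pow_int)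
    also have "\<dots> = \<one>" using d dv int_pow_eq_id[OF d] by (simp add: int_pow_pow)
    finally show ?thesis unfolding U_def using comm_D[OF d g] hg w(1) by auto
  qed
  have DgU: "commutator c g \<in> U" if c: "c \<in> D" for c
  proof -
    obtain n :: nat where n: "c = d [^] n" using c unfolding D_eq by auto
    let ?z = "commutator d g"
    have z: "?z [^] n \<in> U" using gdU by (induction n) auto
    have "c \<otimes> g = g \<otimes> c \<otimes> ?z [^] n"
      unfolding n using pow_central_commutator[OF g d] gdU UZ by blast
    also have "\<dots> = ?z [^] n \<otimes> (g \<otimes> c)"
      using centreD[of "?z [^] n" "g \<otimes> c"] z UZ g d n by auto
    finally have "commutator c g = ?z [^] n" using g d n z by (intro commutator_eqI) auto
    with z show ?thesis by simp
  qed
  have eG: "e \<in> carrier G" using e(1) D.subset by auto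
  define f where "f = g \<otimes> inv e"
  have fG: "f \<in> carrier G" unfolding f_def using g eG by simp
  \<comment> \<open>The commutator of e^(-1) and g lies in U, so it is central and killed by p; thus
    f^p is g^p times the inverse of e^p, which is 1.\<close>
  have fp: "f [^] p = \<one>"
  proof -
    have "inv e \<in> D" using e(1) by simp
    then have "commutator (inv e) g \<in> U" by (rule DgU)
    then have "f [^] p = g [^] p \<otimes> inv e [^] p"
      unfolding f_def using UZ odd_p g eG by (intro odd_pow_mult_distrib) (auto simp: U_def)
    also have "\<dots> = \<one>" using e(2) g eG by (simp add: nat_pow_inv)
    finally show ?thesis .
  qed
  have fD: "f \<notin> D"
  proof
    assume "f \<in> D"
    then have "f \<otimes> e \<in> D" using e(1) by simp
    then show False using gD g eG unfolding f_def by (simp add: m_assoc)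
  qed
  \<comment> \<open>Since e commutes with D, f acts on D as g does.\<close>
  have DfU: "commutator c f \<in> U" if c: "c \<in> D" for c
  proof -
    have cG: "c \<in> carrier G" using c D.subset by auto
    have "c \<otimes> f = commutator c g \<otimes> (g \<otimes> c) \<otimes> inv e"
      unfolding f_def using commutator_swap[OF cG g] cG g eG by (simp flip: m_assoc)
    also have "\<dots> = commutator c g \<otimes> (g \<otimes> (inv e \<otimes> c))"
      using D_comm[OF c, of "inv e"] e(1) cG g eG by (simp add: m_assoc)
    also have "\<dots> = commutator c g \<otimes> (f \<otimes> c)"
      unfolding f_def using cG g eG by (simp add: m_assoc)
    finally have "commutator c f = commutator c g"
      using cG g fG by (intro commutator_eqI) auto
    then show ?thesis using DgU[OF c] by simp
  qed
  \<comment> \<open>The image of f modulo D is central, so a conjugate of f is f c with c in D. Both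
    f and f c have trivial p-th power and (f c)^p = f^p c^p, so c^p = 1, which places c in
    U.\<close>
  have conj_f: "\<exists>u\<in>U. y \<otimes> f \<otimes> inv y = f \<otimes> u" if y: "y \<in> carrier G" for y
  proof -
    let ?c = "commutator (inv f) y"
    have "h f = w" unfolding f_def using g eG hg q.ker[of e] e(1) w(1) by simp
    then have "h (inv f) \<in> centre H"
      using w(1) subgroup.m_inv_closed[OF H.subgroup_centre] fG by simp
    then have cD: "?c \<in> D" using comm_D fG y by simp
    have eq: "y \<otimes> f \<otimes> inv y = f \<otimes> ?c"
      unfolding commutator_def using fG y by (simp add: m_assoc) (simp flip: m_assoc)
    have "f [^] p \<otimes> ?c [^] p = (f \<otimes> ?c) [^] p"
      using DfU[OF cD] UZ odd_p fG y
      by (intro odd_pow_mult_distrib[symmetric]) (auto simp: U_def)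
    also have "\<dots> = \<one>" using eq conj_pow[OF y fG, of p] y fp by simp
    finally have "?c \<in> U" unfolding U_def using cD fp fG y by simp
    with eq show ?thesis by blast
  qed
  have Uc: "u \<otimes> x = x \<otimes> u" if "u \<in> U" "x \<in> carrier G" for u x
    by (rule centreD[OF subsetD[OF UZ that(1)] that(2)])
  define N where "N = {f [^] i \<otimes> u | (i :: nat) u. u \<in> U}"
  have NG: "N \<subseteq> carrier G" unfolding N_def using fG UG by auto
  have subN: "subgroup N G"
  proof (rule subgroupI[OF NG])
    have "f [^] (0 :: nat) \<otimes> \<one> \<in> N" unfolding N_def using U.one_closed by blast
    then show "N \<noteq> {}" by (intro notI) (simp only: empty_iff)
  next
    fix a assume "a \<in> N"
    then obtain i u where a: "a = f [^] (i :: nat) \<otimes> u" "u \<in> U" unfolding N_def by auto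
    have "f [^] ((p - 1) * i) \<otimes> f [^] i = f [^] (p * i)"
      using fG p_gt_1 by (simp add: nat_pow_mult algebra_simps)
    also have "\<dots> = \<one>" using fG fp by (simp flip: nat_pow_pow)
    finally have "inv (f [^] i) = f [^] ((p - 1) * i)" using fG by (intro inv_equality) auto
    moreover have "inv a = inv (f [^] i) \<otimes> inv u"
      using a UG fG Uc[of "inv u" "inv (f [^] i)"] by (auto simp: inv_mult_group)
    ultimately show "inv a \<in> N" unfolding N_def using a(2) by auto
  next
    fix a b assume "a \<in> N" "b \<in> N"
    then obtain i u j v where a: "a = f [^] (i :: nat) \<otimes> u" "u \<in> U" "b = f [^] (j :: nat) \<otimes> v" "v \<in> U"
      unfolding N_def by auto
    have "a \<otimes> b = f [^] i \<otimes> (u \<otimes> f [^] j) \<otimes> v" using a UG fG by (simp add: m_assoc subset_iff)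
    also have "\<dots> = f [^] (i + j) \<otimes> (u \<otimes> v)"
      using Uc[OF a(2), of "f [^] j"] a UG fG by (simp add: m_assoc subset_iff flip: nat_pow_mult)
    finally show "a \<otimes> b \<in> N" unfolding N_def using a by auto
  qed
  have conj_N: "\<exists>v\<in>U. y \<otimes> n \<otimes> inv y = n \<otimes> v" if y: "y \<in> carrier G" and n: "n \<in> N" for y n
  proof -
    obtain i u where nu: "n = f [^] (i :: nat) \<otimes> u" "u \<in> U" using n unfolding N_def by auto
    obtain c where c: "c \<in> U" "y \<otimes> f \<otimes> inv y = f \<otimes> c" using conj_f[OF y] by blast
    have uG: "u \<in> carrier G" "c \<in> carrier G" using nu(2) c(1) UG by auto
    have ci: "c [^] i \<in> U" using c(1) by (induction i) auto
    have "y \<otimes> n \<otimes> inv y = y \<otimes> f [^] i \<otimes> (u \<otimes> inv y)"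
      using nu(1) y fG uG by (simp add: m_assoc)
    also have "\<dots> = (y \<otimes> f [^] i \<otimes> inv y) \<otimes> u"
      using Uc[OF nu(2), of "inv y"] y fG uG by (simp add: m_assoc)
    also have "y \<otimes> f [^] i \<otimes> inv y = f [^] i \<otimes> c [^] i"
      using conj_pow[OF y fG, of i] c pow_mult_distrib[OF _ fG uG(2), of i] Uc[OF c(1) fG] by simp
    also have "f [^] i \<otimes> c [^] i \<otimes> u = n \<otimes> c [^] i"
      using Uc[OF ci uG(1)] nu(1) fG uG by (simp add: m_assoc)
    finally show ?thesis using ci by blast
  qed
  have UN: "U \<subseteq> N"
  proof
    fix u assume "u \<in> U"
    then have "u = f [^] (0 :: nat) \<otimes> u" using UG by auto
    then show "u \<in> N" unfolding N_def using \<open>u \<in> U\<close> by blast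
  qed
  have fN: "f \<in> N"
  proof -
    have "f = f [^] (1 :: nat) \<otimes> \<one>" using fG by simp
    then show ?thesis unfolding N_def using U.one_closed by blast
  qed
  have N_exp: "n [^] p = \<one>" if "n \<in> N" for n
  proof -
    obtain i u where nu: "n = f [^] (i :: nat) \<otimes> u" "u \<in> U" using \<open>n \<in> N\<close> unfolding N_def by auto
    have uG: "u \<in> carrier G" using nu(2) UG by auto
    have "n [^] p = (f [^] i) [^] p \<otimes> u [^] p"
      unfolding nu(1) using Uc[OF nu(2), of "f [^] i"] fG uG by (intro pow_mult_distrib) auto
    also have "(f [^] i) [^] p = (f [^] p) [^] i" using fG by (simp add: nat_pow_pow mult.commute)
    also have "\<dots> \<otimes> u [^] p = \<one>" using fp nu(2) unfolding U_def by simp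
    finally show ?thesis .
  qed
  show thesis
  proof
    show "N \<lhd> G"
    proof (rule normal_invI[OF subN])
      fix y n assume "y \<in> carrier G" "n \<in> N"
      then show "y \<otimes> n \<otimes> inv y \<in> N"
        using conj_N UN subgroup.m_closed[OF subN] by (metis subsetD)
    qed
    show "n [^] p = \<one>" if "n \<in> N" for n by (rule N_exp[OF that])
    show "commutator n y \<in> centre G" if n: "n \<in> N" and y: "y \<in> carrier G" for n y
    proof -
      obtain v where v: "v \<in> U" "y \<otimes> n \<otimes> inv y = n \<otimes> v" using conj_N[OF y n] by blast
      have nG: "n \<in> carrier G" "v \<in> carrier G" using n NG v(1) UG by auto
      have "commutator n y = n \<otimes> inv (y \<otimes> n \<otimes> inv y)"
        unfolding commutator_def using nG y by (simp add: inv_mult_group m_assoc)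
      also have "\<dots> = n \<otimes> (inv v \<otimes> inv n)" unfolding v(2) using nG by (simp add: inv_mult_group)
      also have "\<dots> = inv v" using Uc[of "inv v" "inv n"] v(1) nG by (simp flip: m_assoc)
      finally show ?thesis using v(1) UZ by auto
    qed
    \<comment> \<open>A cyclic p-group has at most p elements killed by p. But U already has at
      least p elements, as d is nontrivial, and N also contains f, which is not in U.\<close>
    show "\<not> N \<subseteq> generate G {a}" if a: "a \<in> carrier G" for a
    proof
      assume "N \<subseteq> generate G {a}"
      then have "card N \<le> p" using N_exp by (rule card_exponent_p_le[OF a])
      moreover have "U \<noteq> {\<one>}"
      proof -
        have "d [^] (p ^ l) \<in> D" unfolding D_eq by blast
        moreover have "(d [^] (p ^ l)) [^] p = \<one>"
          using pow_eq_id[OF d] l d by (simp add: nat_pow_pow mult.commute)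
        moreover have "d [^] (p ^ l) \<noteq> \<one>"
          using pow_eq_id[OF d] l p_gt_1 by (auto dest: dvd_imp_le)
        ultimately show ?thesis unfolding U_def by blast
      qed
      then have "p dvd card U" by (rule nontrivial_subgroup_card[OF subU])
      moreover have "card U > 0"
        by (rule U.finite_imp_card_positive[OF finite_carrier])
      ultimately have "card N \<le> card U" using dvd_imp_le[of p "card U"] by linarith
      moreover have "U \<subset> N" using UN fN fD UD by blast
      then have "card U < card N" using finite_subgroup[OF subN] by (rule psubset_card_mono[rotated])
      ultimately show False by simp
    qed
  qed
qed

end

section \<open>Bounding the class by the coexponent\<close>

context group
begin

text \<open>The classical fact that a group with cyclic central quotient is abelian, phrased by
  decompositions so that no quotient has to be formed: x commutes with its powers and with the
  centre, so x is itself central.\<close>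

lemma cyclic_over_centre_abelian:
  assumes x: "x \<in> carrier G"
    and dec: "\<And>y. y \<in> carrier G \<Longrightarrow> \<exists>(i :: nat). \<exists>n\<in>centre G. y = x [^] i \<otimes> n"
  shows "carrier G \<subseteq> centre G"
proof -
  have comm: "x \<otimes> y = y \<otimes> x" if "y \<in> carrier G" for y
  proof -
    obtain i :: nat and n where y: "n \<in> centre G" "y = x [^] i \<otimes> n"
      using dec[OF \<open>y \<in> carrier G\<close>] by blast
    have "x \<otimes> y = x [^] i \<otimes> (x \<otimes> n)"
      unfolding y(2) using x y(1) nat_pow_Suc2[OF x, of i] by (simp flip: m_assoc)
    also have "\<dots> = y \<otimes> x"
      unfolding y(2) using centreD[OF y(1) x] x y(1) by (simp add: m_assoc)
    finally show ?thesis .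
  qed
  then have xZ: "x \<in> centre G" unfolding centre_def using x by blast
  have pZ: "x [^] i \<in> centre G" for i :: nat
    by (induction i) (use xZ subgroup_centre in \<open>auto intro: subgroup.one_closed subgroup.m_closed\<close>)
  show ?thesis
  proof
    fix y assume "y \<in> carrier G"
    then obtain i :: nat and n where "n \<in> centre G" "y = x [^] i \<otimes> n" using dec by blast
    then show "y \<in> centre G" using subgroup.m_closed[OF subgroup_centre pZ] by simp
  qed
qed

lemma lower_central_1_abelian: "carrier G \<subseteq> centre G \<Longrightarrow> lower_central G (Suc 0) = {\<one>}"
  by (rule lower_central_Suc_trivial) simp

end

section \<open>Cyclic subgroups under passage to a quotient\<close>

context quotient_hom
begin

lemma subgroup_preimage:
  assumes "subgroup K H"
  shows "subgroup {y \<in> carrier G. h y \<in> K} G"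
proof (rule G.subgroupI)
  have "\<one> \<in> {y \<in> carrier G. h y \<in> K}" using subgroup.one_closed[OF assms] by simp
  then show "{y \<in> carrier G. h y \<in> K} \<noteq> {}" by (metis empty_iff)
qed (use assms in \<open>auto intro: subgroup.m_closed subgroup.m_inv_closed\<close>)

lemma decompose:
  assumes "p_group G p" and x: "x \<in> carrier G" and y: "y \<in> carrier G" "h y \<in> generate H {h x}"
  obtains i :: nat and n where "n \<in> N" "y = x [^] i \<otimes> n"
proof -
  interpret HP: p_group H p by (rule p_group_quotient) fact
  obtain i :: nat where i: "h y = h x [^]\<^bsub>H\<^esub> i"
    using HP.generate_singleton[of "h x"] x y(2) by auto
  have "h (inv (x [^] i) \<otimes> y) = \<one>\<^bsub>H\<^esub>"
    using x y(1) i by (simp add: hom_nat_pow)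
  then have "inv (x [^] i) \<otimes> y \<in> N" using ker[of "inv (x [^] i) \<otimes> y"] x y(1) by simp
  moreover have "y = x [^] i \<otimes> (inv (x [^] i) \<otimes> y)" using x y(1) by (simp flip: G.m_assoc)
  ultimately show thesis by (rule that)
qed

text \<open>The preimage of the subgroup generated by \<open>h x\<close> contains x and N. As N is
  not inside the subgroup generated by x, this preimage has order at least p times
  \<open>ord x\<close>; dividing by the order of N shows that the index bound loses a factor
  p.\<close>

lemma order_quotient_le:
  assumes "p_group G p" and x: "x \<in> carrier G" and N: "subgroup N G" "\<not> N \<subseteq> generate G {x}"
    and le: "order G \<le> p ^ Suc f * G.ord x"
  shows "order H \<le> p ^ f * H.ord (h x)"
proof -
  interpret GP: p_group G p by fact
  interpret HP: p_group H p by (rule p_group_quotient) fact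
  let ?K = "{y \<in> carrier G. h y \<in> generate H {h x}}"
  have hx: "h x \<in> carrier H" using x by simp
  have subK: "subgroup ?K G" by (rule subgroup_preimage) (rule HP.subgroup_generate_singleton[OF hx])
  have "x \<in> ?K" using x by (simp add: generate.incl)
  then have "generate G {x} \<subseteq> ?K" using subK by (intro G.generate_subgroup_incl) auto
  moreover have "N \<subseteq> ?K"
  proof
    fix n assume "n \<in> N"
    then show "n \<in> ?K" using ker[of n] N_sub generate.one[of H] by auto
  qed
  ultimately have "generate G {x} \<subset> ?K" using N(2) by blast
  then have "p * card (generate G {x}) \<le> card ?K"
    using GP.proper_subgroup_card[OF GP.subgroup_generate_singleton[OF x] subK] by simp
  also have "card ?K = card N * H.ord (h x)"
    using card_preimage[OF GP.finite_carrier, of "generate H {h x}"] hx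
      subgroup.subset[OF HP.subgroup_generate_singleton[OF hx]] by (simp add: H.generate_pow_card)
  finally have "p * G.ord x \<le> card N * H.ord (h x)" by (simp add: G.generate_pow_card[OF x])
  then have "p ^ f * (p * G.ord x) \<le> p ^ f * (card N * H.ord (h x))" by (rule mult_le_mono2)
  then have "p ^ Suc f * G.ord x \<le> card N * (p ^ f * H.ord (h x))"
    by (simp only: power_Suc mult_ac)
  then have "card N * order H \<le> card N * (p ^ f * H.ord (h x))"
    using le order_kernel[OF GP.finite_carrier] by linarith
  moreover have "card N > 0" using subgroup.finite_imp_card_positive[OF N(1) GP.finite_carrier] .
  ultimately show ?thesis by simp
qed

end

section \<open>Groups of order at most p^3, and cyclic subgroups of index p and p^2\<close>

context p_group
begin

lemma cyclic_abelian:
  assumes "x \<in> carrier G" "generate G {x} = carrier G"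
  shows "carrier G \<subseteq> centre G"
proof (rule cyclic_over_centre_abelian[OF assms(1)])
  fix y assume "y \<in> carrier G"
  then obtain i :: nat where "y = x [^] i" using assms generate_singleton[OF assms(1)] by auto
  then have "y = x [^] i \<otimes> \<one>" using assms(1) by simp
  then show "\<exists>(i :: nat). \<exists>n\<in>centre G. y = x [^] i \<otimes> n"
    using subgroup.one_closed[OF subgroup_centre] by blast
qed

text \<open>A nontrivial central w generates a subgroup of index at most p. If y lies outside it,
  the centralizer of y contains it properly and so is everything.\<close>

lemma order_le_p2_abelian:
  assumes "order G \<le> p ^ 2"
  shows "carrier G \<subseteq> centre G"
proof (cases "carrier G = {\<one>}")
  case True
  then show ?thesis using subgroup.one_closed[OF subgroup_centre] by simp
next
  case False
  then obtain w where w: "w \<in> centre G" "w \<noteq> \<one>" using central_of_order_p by blast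
  have wG: "w \<in> carrier G" using w(1) by simp
  have sub: "subgroup (generate G {w}) G" by (rule subgroup_generate_singleton[OF wG])
  have wA: "w \<in> generate G {w}" by (simp add: generate.incl)
  have "p dvd card (generate G {w})"
    by (rule nontrivial_subgroup_card[OF sub]) (use wA w(2) in auto)
  then have "p \<le> card (generate G {w})"
    using subgroup.finite_imp_card_positive[OF sub finite_carrier] by (rule dvd_imp_le)
  then have le: "order G \<le> p * card (generate G {w})"
    using assms by (metis le_trans mult_le_mono2 power2_eq_square)
  have AZ: "generate G {w} \<subseteq> centre G"
    using w(1) subgroup_centre by (intro generate_subgroup_incl) auto
  show ?thesis
  proof
    fix y assume y: "y \<in> carrier G"
    let ?K = "{k \<in> carrier G. k \<otimes> y = y \<otimes> k}"
    show "y \<in> centre G"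
    proof (cases "y \<in> generate G {w}")
      case False
      have "generate G {w} \<subseteq> ?K" using AZ y centreD[of _ y] by (auto simp del: centre_carrier intro: centre_carrier)
      moreover have "y \<in> ?K" using y by simp
      ultimately have "generate G {w} \<subset> ?K" using False by blast
      then have "?K = carrier G"
        by (rule proper_supergroup_eq_carrier[OF sub subgroup_centralizer[OF y] _ le])
      then have "\<forall>k\<in>carrier G. k \<otimes> y = y \<otimes> k" by blast
      then show ?thesis unfolding centre_def using y by (intro CollectI conjI ballI) metis+
    qed (use AZ in blast)
  qed
qed

lemma order_le_p3_class:
  assumes "order G \<le> p ^ 3"
  shows "lower_central G 2 = {\<one>}"
proof (cases "carrier G = {\<one>}")
  case True
  then show ?thesis by (intro lower_central_trivial_mono[of 0]) auto
next
  case False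
  then have "centre G \<noteq> {\<one>}" using central_of_order_p by blast
  then have "p dvd card (centre G)" by (rule nontrivial_subgroup_card[OF subgroup_centre])
  then have pc: "p \<le> card (centre G)"
    using subgroup.finite_imp_card_positive[OF subgroup_centre finite_carrier] by (rule dvd_imp_le)
  obtain H :: "nat monoid" and h where q: "quotient_hom G H h (centre G)"
    using quotient_hom_exists[OF finite_carrier centre_normal] .
  interpret H: p_group H p using q by (rule quotient_hom.p_group_quotient) (rule p_group_axioms)
  interpret q: quotient_hom G H h "centre G" by (rule q)
  have "p * order H \<le> card (centre G) * order H" using pc by simp
  also have "\<dots> \<le> p * p ^ 2"
    using assms q.order_kernel[OF finite_carrier] by (simp add: power3_eq_cube power2_eq_square)
  finally have "order H \<le> p ^ 2" using p_gt_1 by simp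
  then have "lower_central H (Suc 0) = {\<one>\<^bsub>H\<^esub>}"
    by (intro H.lower_central_1_abelian H.order_le_p2_abelian)
  then have "lower_central G (Suc 0) \<subseteq> centre G" by (rule q.lower_central_subset_kernel)
  then show ?thesis unfolding numeral_2_eq_2 by (rule lower_central_Suc_trivial)
qed

text \<open>Modulo the centre of G the elements of N become central, so the quotient is generated by
  the image of x together with its own centre and is therefore abelian.\<close>

lemma commutators_central:
  assumes x: "x \<in> carrier G" and N: "N \<subseteq> carrier G"
    and NZ: "\<And>n y. n \<in> N \<Longrightarrow> y \<in> carrier G \<Longrightarrow> commutator n y \<in> centre G"
    and dec: "\<And>y. y \<in> carrier G \<Longrightarrow> \<exists>(i :: nat). \<exists>n\<in>N. y = x [^] i \<otimes> n"
    and ab: "a \<in> carrier G" "b \<in> carrier G"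
  shows "commutator a b \<in> centre G"
proof -
  obtain H :: "nat monoid" and h where "quotient_hom G H h (centre G)"
    using quotient_hom_exists[OF finite_carrier centre_normal] .
  then interpret q: quotient_hom G H h "centre G" .
  have hN: "h n \<in> centre H" if "n \<in> N" for n
  proof -
    have n: "n \<in> carrier G" using that N by auto
    have "h n \<otimes>\<^bsub>H\<^esub> t = t \<otimes>\<^bsub>H\<^esub> h n" if t: "t \<in> carrier H" for t
    proof -
      obtain y where y: "y \<in> carrier G" "t = h y" using t q.surj by auto
      have "h (commutator n y) = \<one>\<^bsub>H\<^esub>" using NZ[OF \<open>n \<in> N\<close> y(1)] q.ker n y(1) by simp
      then show ?thesis using n y by (simp add: q.hom_commutator q.H.commutator_eq_one)
    qed
    then show ?thesis unfolding centre_def using n by auto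
  qed
  have "carrier H \<subseteq> centre H"
  proof (rule q.H.cyclic_over_centre_abelian[of "h x"])
    fix t assume "t \<in> carrier H"
    then obtain y where y: "y \<in> carrier G" "t = h y" using q.surj by auto
    obtain i :: nat and n where n: "n \<in> N" "y = x [^] i \<otimes> n" using dec[OF y(1)] by blast
    then have "t = h x [^]\<^bsub>H\<^esub> i \<otimes>\<^bsub>H\<^esub> h n" using y(2) x N by (auto simp: q.hom_nat_pow)
    then show "\<exists>(i :: nat). \<exists>n\<in>centre H. t = h x [^]\<^bsub>H\<^esub> i \<otimes>\<^bsub>H\<^esub> n" using hN[OF n(1)] by blast
  qed (use x in simp)
  then have "h a \<in> centre H" using ab q.hom_closed by blast
  then have "h (commutator a b) = \<one>\<^bsub>H\<^esub>"
    using ab q.H.centreD[of "h a" "h b"] by (simp add: q.hom_commutator q.H.commutator_eq_one)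
  then show ?thesis using q.ker ab by simp
qed

text \<open>Passing to the quotient by N lowers the index bound from p to 1, so the image of x
  generates it. Every element is then a power of x times an element of N.\<close>

lemma index_p_commutators_central:
  assumes odd_p: "odd p" and x: "x \<in> carrier G" and le: "order G \<le> p * ord x"
    and ab: "a \<in> carrier G" "b \<in> carrier G"
  shows "commutator a b \<in> centre G"
proof (cases "\<exists>x\<in>carrier G. generate G {x} = carrier G")
  case True
  then have "carrier G \<subseteq> centre G" using cyclic_abelian by blast
  then show ?thesis using ab by blast
next
  case False
  then obtain N where N: "N \<lhd> G" "\<And>n y. n \<in> N \<Longrightarrow> y \<in> carrier G \<Longrightarrow> commutator n y \<in> centre G"
    "\<And>a. a \<in> carrier G \<Longrightarrow> \<not> N \<subseteq> generate G {a}"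
    using exists_normal_not_in_cyclic[OF odd_p] by (metis (no_types, lifting))
  have sub: "subgroup N G" using N(1) normal_imp_subgroup by blast
  obtain H :: "nat monoid" and h where q: "quotient_hom G H h N"
    using quotient_hom_exists[OF finite_carrier N(1)] .
  interpret H: p_group H p using q by (rule quotient_hom.p_group_quotient) (rule p_group_axioms)
  interpret q: quotient_hom G H h N by (rule q)
  have hx: "h x \<in> carrier H" using x by simp
  have "order H \<le> p ^ 0 * H.ord (h x)"
    by (rule q.order_quotient_le[OF p_group_axioms x sub N(3)[OF x]]) (use le in simp)
  then have "generate H {h x} = carrier H"
    using H.generate_pow_card[OF hx] H.finite_carrier
      subgroup.subset[OF H.subgroup_generate_singleton[OF hx]]
    by (intro card_seteq) (auto simp: order_def)
  then have "\<exists>(i :: nat). \<exists>n\<in>N. y = x [^] i \<otimes> n" if "y \<in> carrier G" for y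
    using q.decompose[OF p_group_axioms x that] that by (metis q.hom_closed)
  then show ?thesis
    using commutators_central[OF x subgroup.subset[OF sub] N(2) _ ab] by blast
qed

lemma index_p_class:
  assumes "odd p" "x \<in> carrier G" "order G \<le> p * ord x"
  shows "lower_central G 2 = {\<one>}"
proof -
  have "lower_central G (Suc 0) \<subseteq> centre G"
    unfolding lower_central.simps
    by (rule commutator_subgroup_subset[OF subgroup_centre])
      (use index_p_commutators_central[OF assms] in auto)
  then show ?thesis unfolding numeral_2_eq_2 by (rule lower_central_Suc_trivial)
qed

text \<open>If the subgroup generated by x contains the centre, it contains all commutators. If not,
  the centralizer of x is strictly larger than it, hence everything, and x is central.\<close>

lemma index_p_normal:
  assumes odd_p: "odd p" and x: "x \<in> carrier G" and le: "order G \<le> p * ord x"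
  shows "generate G {x} \<lhd> G"
proof (rule normal_generate_singleton[OF x])
  fix y assume y: "y \<in> carrier G"
  have sub: "subgroup (generate G {x}) G" by (rule subgroup_generate_singleton[OF x])
  have xA: "x \<in> generate G {x}" by (simp add: generate.incl)
  show "y \<otimes> x \<otimes> inv y \<in> generate G {x}"
  proof (cases "centre G \<subseteq> generate G {x}")
    case True
    then have "commutator y x \<in> generate G {x}"
      using index_p_commutators_central[OF odd_p x le y x] by blast
    then show ?thesis
      using conj_eq_commutator_mult[OF y x] subgroup.m_closed[OF sub _ xA] by simp
  next
    case False
    let ?K = "{k \<in> carrier G. k \<otimes> x = x \<otimes> k}"
    have "generate G {x} \<subseteq> ?K"
      by (rule generate_subgroup_incl[OF _ subgroup_centralizer[OF x]]) (use x in simp)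
    moreover have "centre G \<subseteq> ?K" unfolding centre_def using x by blast
    ultimately have "generate G {x} \<subset> ?K" using False by blast
    then have "?K = carrier G"
      using le generate_pow_card[OF x]
      by (intro proper_supergroup_eq_carrier[OF sub subgroup_centralizer[OF x]]) simp_all
    then have "y \<otimes> x = x \<otimes> y" using y by blast
    then have "y \<otimes> x \<otimes> inv y = x" using x y by (simp add: m_assoc)
    then show ?thesis using xA by simp
  qed
qed

lemma index_p2_class:
  assumes odd_p: "odd p" and x: "x \<in> carrier G" and le: "order G \<le> p ^ 2 * ord x"
  shows "lower_central G 3 = {\<one>}"
proof (cases "\<exists>x\<in>carrier G. generate G {x} = carrier G")
  case True
  then have "lower_central G (Suc 0) = {\<one>}" using cyclic_abelian lower_central_1_abelian by blast
  then show ?thesis by (intro lower_central_trivial_mono[of "Suc 0"]) auto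
next
  case False
  then obtain N where N: "N \<lhd> G" "\<And>n. n \<in> N \<Longrightarrow> n [^] p = \<one>"
    "\<And>n y. n \<in> N \<Longrightarrow> y \<in> carrier G \<Longrightarrow> commutator n y \<in> centre G"
    "\<And>a. a \<in> carrier G \<Longrightarrow> \<not> N \<subseteq> generate G {a}"
    using exists_normal_not_in_cyclic[OF odd_p] by (metis (no_types, lifting))
  interpret N: normal N G by (rule N(1))
  obtain H :: "nat monoid" and h where q: "quotient_hom G H h N"
    using quotient_hom_exists[OF finite_carrier N(1)] .
  interpret H: p_group H p using q by (rule quotient_hom.p_group_quotient) (rule p_group_axioms)
  interpret q: quotient_hom G H h N by (rule q)
  have hx: "h x \<in> carrier H" using x by simp
  have "order H \<le> p ^ 1 * H.ord (h x)"
    by (rule q.order_quotient_le[OF p_group_axioms x N.subgroup_axioms N(4)[OF x]])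
      (use le in \<open>simp add: power2_eq_square\<close>)
  then have leH: "order H \<le> p * H.ord (h x)" by simp
  have lcN: "lower_central G 2 \<subseteq> N"
    by (rule q.lower_central_subset_kernel[OF H.index_p_class[OF odd_p hx leH]])
  let ?B = "generate G {x [^] p}"
  have xp: "x [^] p \<in> carrier G" using x by simp
  \<comment> \<open>Modulo N the image of x generates a subgroup of index at most p, which is
    normal; so a conjugate of x is x^i n with n in N. The commutator of n and x^i is central and,
    lying in N, killed by p. Hence the p-th power of x^i n is (x^p)^i, because n^p = 1.\<close>
  have "?B \<lhd> G"
  proof (rule normal_generate_singleton[OF xp])
    fix y assume y: "y \<in> carrier G"
    have "h y \<otimes>\<^bsub>H\<^esub> h x \<otimes>\<^bsub>H\<^esub> inv\<^bsub>H\<^esub> h y \<in> generate H {h x}"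
      using H.normal_invE(2)[OF H.index_p_normal[OF odd_p hx leH]] y by (simp add: generate.incl)
    then have "h (y \<otimes> x \<otimes> inv y) \<in> generate H {h x}" using x y by simp
    moreover have "y \<otimes> x \<otimes> inv y \<in> carrier G" using x y by simp
    ultimately obtain i :: nat and n where n: "n \<in> N" "y \<otimes> x \<otimes> inv y = x [^] i \<otimes> n"
      using q.decompose[OF p_group_axioms x] by blast
    have nG: "n \<in> carrier G" using n(1) by simp
    have "x [^] i \<otimes> inv n \<otimes> inv (x [^] i) \<in> N"
      using normal_invE(2)[OF N(1), of "x [^] i" "inv n"] x n(1) by simp
    then have "commutator n (x [^] i) \<in> N"
      unfolding commutator_def using n(1) nG x N.m_closed[OF n(1)] by (simp add: m_assoc)
    then have "commutator n (x [^] i) [^] p = \<one>" by (rule N(2))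
    then have "(x [^] i \<otimes> n) [^] p = (x [^] i) [^] p \<otimes> n [^] p"
      using N(3)[OF n(1), of "x [^] i"] x nG odd_p by (intro odd_pow_mult_distrib) auto
    also have "\<dots> = (x [^] p) [^] i" using N(2)[OF n(1)] x by (simp add: nat_pow_pow mult.commute)
    finally have "y \<otimes> x [^] p \<otimes> inv y = (x [^] p) [^] i" using conj_pow[OF y x, of p] n(2) by simp
    then show "y \<otimes> x [^] p \<otimes> inv y \<in> ?B" using generate_singleton[OF xp] by auto
  qed
  \<comment> \<open>Only an inequality, since for x = 1 passing to x^p does not reduce the
    order.\<close>
  have "ord x \<le> p * card ?B"
  proof -
    have "ord x dvd p * ord (x [^] p)"
      using pow_ord_eq_1[OF xp] unfolding nat_pow_pow[OF x] pow_eq_id[OF x] .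
    moreover have "ord (x [^] p) > 0" using ord_ge_1[OF finite_carrier xp] by simp
    ultimately show ?thesis using generate_pow_card[OF xp] p_gt_1 by (simp add: dvd_imp_le)
  qed
  then have "p ^ 2 * ord x \<le> p ^ 2 * (p * card ?B)" by (rule mult_le_mono2)
  also have "\<dots> = p ^ 3 * card ?B" by (simp add: power3_eq_cube power2_eq_square mult.assoc)
  finally have leB: "order G \<le> p ^ 3 * card ?B" using le by linarith
  have subB: "subgroup ?B G" by (rule subgroup_generate_singleton[OF xp])
  obtain Q :: "nat monoid" and r where r: "quotient_hom G Q r ?B"
    using quotient_hom_exists[OF finite_carrier \<open>?B \<lhd> G\<close>] .
  interpret Q: p_group Q p using r by (rule quotient_hom.p_group_quotient) (rule p_group_axioms)
  interpret r: quotient_hom G Q r ?B by (rule r)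
  have "order Q \<le> p ^ 3"
    using leB r.order_kernel[OF finite_carrier]
      subgroup.finite_imp_card_positive[OF subB finite_carrier] by (simp add: mult.commute)
  then have lcB: "lower_central G 2 \<subseteq> ?B"
    by (intro r.lower_central_subset_kernel Q.order_le_p3_class)
  have "?B \<subseteq> generate G {x}"
    using subgroup_generate_singleton[OF x] generate_singleton[OF x]
    by (intro generate_subgroup_incl) auto
  \<comment> \<open>The intersection lies in the cyclic group generated by x and inherits exponent p
    from N.\<close>
  then have "card (N \<inter> ?B) \<le> p"
    by (intro card_exponent_p_le[OF x]) (use N(2) in auto)
  then have "N \<inter> ?B \<subseteq> centre G"
    using normal_subgroup_intersect[OF N(1) \<open>?B \<lhd> G\<close>] by (intro small_normal_central)
  then have "lower_central G 2 \<subseteq> centre G" using lcN lcB by blast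
  then show ?thesis unfolding numeral_2_eq_2 numeral_3_eq_3 by (rule lower_central_Suc_trivial)
qed

text \<open>The hypothesis \<open>IH\<close> speaks only of groups on \<open>nat\<close>, where the
  quotients live, while G may have any carrier type. So the same step serves inside the induction
  and for the one descent from an arbitrary type.\<close>

lemma class_bound_step:
  assumes odd_p: "odd p" and x: "x \<in> carrier G" and le: "order G \<le> p ^ Suc f * ord x"
    and IH: "\<And>(H :: nat monoid) y. p_group H p \<Longrightarrow> y \<in> carrier H \<Longrightarrow>
      order H \<le> p ^ f * group.ord H y \<Longrightarrow> lower_central H c = {\<one>\<^bsub>H\<^esub>}"
  shows "lower_central G (c + 2) = {\<one>}"
proof (cases "\<exists>x\<in>carrier G. generate G {x} = carrier G")
  case True
  then have "lower_central G (Suc 0) = {\<one>}" using cyclic_abelian lower_central_1_abelian by blast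
  then show ?thesis by (intro lower_central_trivial_mono[of "Suc 0"]) auto
next
  case False
  then obtain N where N: "N \<lhd> G" "\<And>n y. n \<in> N \<Longrightarrow> y \<in> carrier G \<Longrightarrow> commutator n y \<in> centre G"
    "\<And>a. a \<in> carrier G \<Longrightarrow> \<not> N \<subseteq> generate G {a}"
    using exists_normal_not_in_cyclic[OF odd_p] by (metis (no_types, lifting))
  obtain H :: "nat monoid" and h where q: "quotient_hom G H h N"
    using quotient_hom_exists[OF finite_carrier N(1)] .
  interpret q: quotient_hom G H h N by (rule q)
  have "order H \<le> p ^ f * q.H.ord (h x)"
    using q.order_quotient_le[OF p_group_axioms x normal_imp_subgroup[OF N(1)] N(3)[OF x] le] .
  then have "lower_central H c = {\<one>\<^bsub>H\<^esub>}"
    using x by (intro IH[of H "h x"] q.p_group_quotient p_group_axioms) auto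
  then have "lower_central G c \<subseteq> N" by (rule q.lower_central_subset_kernel)
  then have "lower_central G (Suc c) \<subseteq> centre G"
    unfolding lower_central.simps
    by (intro commutator_subgroup_subset[OF subgroup_centre] N(2)) auto
  then show ?thesis unfolding add_2_eq_Suc' by (rule lower_central_Suc_trivial)
qed

end

section \<open>Induction on the index exponent, and the link to the coexponent\<close>

lemma class_bound_nat:
  fixes G :: "nat monoid"
  assumes "p_group G p" "odd p" "x \<in> carrier G" "order G \<le> p ^ (f + 2) * group.ord G x"
  shows "lower_central G (2 * f + 3) = {\<one>\<^bsub>G\<^esub>}"
  using assms
proof (induction f arbitrary: G x)
  case 0
  \<comment> \<open>With exponent f + 2 the bound 2(f + 2) - 1 reads 2f + 3, free of truncated
    subtraction.\<close>
  then have "lower_central G 3 = {\<one>\<^bsub>G\<^esub>}"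
    by (intro p_group.index_p2_class[of G p x]) (simp_all add: power2_eq_square)
  then show ?case by simp
next
  case (Suc f)
  then interpret p_group G p by simp
  have "lower_central G ((2 * f + 3) + 2) = {\<one>\<^bsub>G\<^esub>}"
    by (rule class_bound_step[OF Suc.prems(2,3), of "f + 2"]) (use Suc in auto)
  then show ?case by (simp add: add.commute)
qed

text \<open>For f = 2 no quotient on \<open>nat\<close> has to be bounded inductively. For larger f
  one step leads to a quotient on \<open>nat\<close> with exponent f - 1 = k + 2, where the
  induction gives 2k + 3.\<close>

lemma (in p_group) class_bound:
  assumes "odd p" "x \<in> carrier G" "order G \<le> p ^ f * ord x" "f \<ge> 2"
  shows "lower_central G (2 * f - 1) = {\<one>}"
proof (cases "f = 2")
  case True
  then show ?thesis using index_p2_class assms by simp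
next
  case False
  define k where "k = f - 3"
  have k: "f = Suc (k + 2)" using False \<open>f \<ge> 2\<close> unfolding k_def by simp
  have "lower_central G ((2 * k + 3) + 2) = {\<one>}"
    by (rule class_bound_step[OF assms(1,2), of "k + 2"]) (use class_bound_nat assms k in auto)
  moreover have "(2 * k + 3) + 2 = 2 * f - 1" using k by simp
  ultimately show ?thesis by metis
qed

lemma (in p_group) coexponent_generator:
  obtains x where "x \<in> carrier G" "order G = p ^ coexponent p G * ord x"
proof -
  let ?P = "\<lambda>k. \<exists>H. subgroup H G \<and> cyclic_group (G\<lparr>carrier := H\<rparr>) \<and> card (rcosets H) = p ^ k"
  obtain n where n: "order G = p ^ n" using order_power by blast
  have "cyclic_group (G\<lparr>carrier := {\<one>}\<rparr>)"
    using subgroup_imp_group[OF triv_subgroup]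
    by (intro trivial_imp_cyclic_group) (simp add: trivial_group_def)
  \<comment> \<open>The trivial subgroup, whose index is the full order p^n, shows that the
    \<open>LEAST\<close> in \<open>coexponent\<close> is attained.\<close>
  then have "?P n" 
    using triv_subgroup card_rcosets_triv[OF finite_carrier] n by (intro exI[of _ "{\<one>}"]) simp
  then have "?P (coexponent p G)" unfolding coexponent_def by (rule LeastI)
  then obtain H where H: "subgroup H G" "cyclic_group (G\<lparr>carrier := H\<rparr>)"
    "card (rcosets H) = p ^ coexponent p G" by blast
  interpret K: group "G\<lparr>carrier := H\<rparr>" by (rule subgroup_imp_group[OF H(1)])
  obtain x where x: "x \<in> H" "H = range (\<lambda>n::int. x [^]\<^bsub>G\<lparr>carrier := H\<rparr>\<^esub> n)"
    using H(2) K.cyclic_group by auto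
  have xG: "x \<in> carrier G" using x(1) H(1) subgroup.subset by blast
  have "H = {x [^] (k :: int) | k. k \<in> UNIV}"
    using x(2) int_pow_consistent[OF H(1) x(1)] by auto
  then have "card H = ord x" using generate_pow[OF xG] generate_pow_card[OF xG] by simp
  then show thesis using that[OF xG] lagrange[OF H(1)] H(3) by simp
qed

theorem theorem2:
  fixes p :: nat and P :: "('a, 'b) monoid_scheme"
  assumes "Factorial_Ring.prime p" and "p > 3"
    and "finite_p_group p P"
    and "coexponent p P \<ge> 2"
  shows "nilpotency_class P \<le> 2 * coexponent p P - 1"
proof -
  interpret p_group P p
    using assms(1,3) unfolding finite_p_group_def p_group_def p_group_axioms_def by simp
  have "odd p" using assms(1,2) by (intro prime_odd_nat) auto
  obtain x where "x \<in> carrier P" "order P = p ^ coexponent p P * ord x"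
    using coexponent_generator .
  then have "lower_central P (2 * coexponent p P - 1) = {\<one>\<^bsub>P\<^esub>}"
    using class_bound \<open>odd p\<close> assms(4) by simp
  \<comment> \<open>As \<open>lower_central P c\<close> is gamma_(c+1)(P), its triviality means
    class at most c, with no shift of the index.\<close>
  then show ?thesis unfolding nilpotency_class_def by (rule Least_le)
qed

end
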